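(* Let $x$ be a factor of the Thue--Morse word $\mathbf{t}$ that begins with $1001$ and ends with $1001$, i.e. $x = 1001x'' = x'1001$ for some words $x', x''$. Then the word $x101100x101100$ is cubefree.
   Context: Let $\mu$ be the morphism on $\{0,1\}^*$ with $\mu(0)=01$, $\mu(1)=10$. The Thue--Morse word $\mathbf{t} = 011010011001011010010110\cdots$ is the infinite word obtained by iterating $\mu$ on $0$. A factor is a contiguous finite subword. A cube is a non-empty word of the form $uuu$; a word is cubefree if none of its factors is a cube. *)

theory Defs
  imports Main "HOL-Library.Z2" "HOL-Library.Sublist"
begin

text \<open>
  Words over the alphabet \<open>{0, 1}\<close> are lists over the two-element type \<^typ>\<open>bit\<close>;
  infinite words are functions \<^typ>\<open>nat \<Rightarrow> bit\<close>.
\<close>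

definition mu_letter :: "bit \<Rightarrow> bit list" where
  "mu_letter a = (if a = 0 then [0, 1] else [1, 0])"

definition mu :: "bit list \<Rightarrow> bit list" where
  "mu w = concat (map mu_letter w)"

text \<open>
  The word \<open>mu^n(0)\<close> has length \<open>2^n > n\<close> and is a prefix of all later iterates, so the
  limit of the iterates can be read off on the diagonal; see \<open>thue_morse_iterate\<close> below.
\<close>

definition thue_morse :: "nat \<Rightarrow> bit" where
  "thue_morse n = (mu ^^ n) [0] ! n"

definition factor_of_inf :: "'a list \<Rightarrow> (nat \<Rightarrow> 'a) \<Rightarrow> bool" where
  "factor_of_inf w s \<longleftrightarrow> (\<exists>i. w = map s [i..<i + length w])"

definition cube :: "'a list \<Rightarrow> bool" where
  "cube w \<longleftrightarrow> w \<noteq> [] \<and> (\<exists>u. w = u @ u @ u)"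

definition cubefree :: "'a list \<Rightarrow> bool" where
  "cubefree w \<longleftrightarrow> \<not> (\<exists>v. sublist v w \<and> cube v)"

lemma mu_append: "mu (u @ v) = mu u @ mu v"
  by (simp add: mu_def)

lemma length_mu: "length (mu w) = 2 * length w"
  by (induction w) (auto simp: mu_def mu_letter_def)

lemma length_mu_iterate: "length ((mu ^^ n) [0]) = 2 ^ n"
  by (induction n) (auto simp: length_mu)

lemma prefix_mu: "prefix u v \<Longrightarrow> prefix (mu u) (mu v)"
  by (auto simp: prefix_def mu_append)

lemma prefix_mu_iterate_Suc: "prefix ((mu ^^ n) [0]) ((mu ^^ Suc n) [0])"
proof (induction n)
  case 0
  show ?case by (simp add: mu_def mu_letter_def)
next
  case (Suc n)
  then show ?case using prefix_mu by fastforce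
qed

lemma prefix_mu_iterate:
  assumes "m \<le> n"
  shows "prefix ((mu ^^ m) [0]) ((mu ^^ n) [0])"
  using assms
proof (induction n rule: dec_induct)
  case base
  show ?case by simp
next
  case (step n)
  then show ?case using prefix_mu_iterate_Suc prefix_order.trans by blast
qed

lemma thue_morse_iterate: "(mu ^^ n) [0] = map thue_morse [0..<2 ^ n]"
proof (rule nth_equalityI)
  show "length ((mu ^^ n) [0]) = length (map thue_morse [0..<2 ^ n])"
    by (simp add: length_mu_iterate)
next
  fix i
  assume "i < length ((mu ^^ n) [0])"
  then have i: "i < 2 ^ n" by (simp add: length_mu_iterate)
  have i': "i < 2 ^ i" by (rule less_exp)
  have "(mu ^^ n) [0] ! i = (mu ^^ i) [0] ! i"
  proof (cases "i \<le> n")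
    case True
    then show ?thesis
      using prefix_mu_iterate[OF True] i' by (auto simp: prefix_def nth_append length_mu_iterate)
  next
    case False
    then have "n \<le> i" by simp
    from prefix_mu_iterate[OF this] show ?thesis
      using i by (auto simp: prefix_def nth_append length_mu_iterate)
  qed
  then show "(mu ^^ n) [0] ! i = map thue_morse [0..<2 ^ n] ! i"
    using i by (simp add: thue_morse_def)
qed

end

theory Submission
  imports Defs
begin

text \<open>
  Occurrences of \<open>1001\<close> in the Thue--Morse word start at even positions, so \<open>x = \<mu>(y)\<close>
  with \<open>y\<close> a factor beginning and ending with \<open>10\<close>. Cut into blocks of length two, the word
  \<open>x101100x101100\<close> consists of blocks \<open>01\<close> and \<open>10\<close>, except for two blocks \<open>11\<close> and two blocks
  \<open>00\<close>. A cube of even period cannot contain such an exceptional block, so it lies in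
  \<open>0\<mu>(y1)1\<close> and yields a cube in \<open>1y1\<close>; this is excluded by overlap-freeness of
  the Thue--Morse word and the known letters at both ends. In a cube of odd period every pair of
  equal adjacent letters is at an even position or is moved to one by a shift by the period, so
  it comes from an exceptional block. The equal pairs next to the exceptional blocks then leave
  only finitely many relations between the period and the length of \<open>x\<close>, each refuted by a mismatch.
\<close>

section \<open>Overlap-freeness of the Thue--Morse word\<close>

lemma bit_neq_trans: "a \<noteq> b \<Longrightarrow> b \<noteq> c \<Longrightarrow> a = c" for a b c :: bit
  by (metis (full_types) bit_not_one_iff)

text \<open>Otherwise the letters alternate, and an odd shift changes the letter.\<close>

lemma odd_period_equal_pair:
  fixes f :: "nat \<Rightarrow> bit"
  assumes "odd p" and "f a = f (a + p)"
  obtains j where "a \<le> j" "j < a + p" "f j = f (Suc j)"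
proof -
  have "\<exists>j. a \<le> j \<and> j < a + p \<and> f j = f (Suc j)"
  proof (rule ccontr)
    assume none: "\<not> ?thesis"
    have "(f (a + k) = f a) = even k" if "k \<le> p" for k
      using that
    proof (induction k)
      case 0
      then show ?case by simp
    next
      case (Suc k)
      then have "f (a + k) \<noteq> f (a + Suc k)"
        using none by auto
      with Suc show ?case
        using bit_neq_trans[of "f (a + Suc k)" "f (a + k)" "f a"] by auto
    qed
    from this[of p] assms show False by simp
  qed
  with that show ?thesis by blast
qed

lemma thue_morse_double:
  "thue_morse (2 * n) = thue_morse n"
  "thue_morse (Suc (2 * n)) = 1 + thue_morse n"
proof -
  have mu_nth: "mu w ! (2 * k) = w ! k \<and> mu w ! Suc (2 * k) = 1 + w ! k"
    if "k < length w" for w k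
    using that
  proof (induction w arbitrary: k)
    case Nil
    then show ?case by simp
  next
    case (Cons b w)
    have "mu (b # w) = b # (1 + b) # mu w"
      by (cases b) (auto simp: mu_def mu_letter_def)
    with Cons show ?case
      by (cases k) auto
  qed
  have n: "n < 2 ^ n" by (rule less_exp)
  have "mu (map thue_morse [0..<2 ^ n]) = map thue_morse [0..<2 ^ Suc n]"
    by (metis thue_morse_iterate funpow.simps(2) o_apply)
  with mu_nth[of n "map thue_morse [0..<2 ^ n]"] n
  show "thue_morse (2 * n) = thue_morse n" "thue_morse (Suc (2 * n)) = 1 + thue_morse n"
    by (auto simp: nth_map simp del: map_upt_Suc upt_Suc)
qed

lemma thue_morse_pair: "even k \<Longrightarrow> thue_morse k \<noteq> thue_morse (Suc k)"
  by (elim evenE) (simp add: thue_morse_double)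

text \<open>Descent on the period. For odd \<open>q\<close>, an equal pair and its translate by
  \<open>q\<close> start at positions of opposite parity, so one of them is an aligned block
  \<open>00\<close> or \<open>11\<close>. For even \<open>q\<close>, the letters at positions of the
  parity of \<open>a\<close> form an overlap of period \<open>q / 2\<close>.\<close>

lemma thue_morse_overlap_free:
  assumes "0 < q" and "\<And>j. a \<le> j \<Longrightarrow> j \<le> a + q \<Longrightarrow> thue_morse j = thue_morse (j + q)"
  shows False
  using assms
proof (induction q arbitrary: a rule: less_induct)
  case (less q)
  show False
  proof (cases "even q")
    case False
    obtain j where j: "a \<le> j" "j < a + q" "thue_morse j = thue_morse (Suc j)"
      using odd_period_equal_pair[OF False less.prems(2)[of a]] by auto
    then have "thue_morse (j + q) = thue_morse (Suc (j + q))"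
      using less.prems(2)[of j] less.prems(2)[of "Suc j"] by simp
    with j False thue_morse_pair[of j] thue_morse_pair[of "j + q"] show False
      by auto
  next
    case True
    then obtain r where r: "q = 2 * r" by (elim evenE)
    have "thue_morse j = thue_morse (j + r)" if j: "a div 2 \<le> j" "j \<le> a div 2 + r" for j
    proof (cases "even a")
      case True
      with j r have "thue_morse (2 * j) = thue_morse (2 * j + q)"
        by (intro less.prems(2)) auto
      with r show ?thesis
        by (metis distrib_left thue_morse_double(1))
    next
      case False
      with j r have "thue_morse (Suc (2 * j)) = thue_morse (Suc (2 * j) + q)"
        by (intro less.prems(2)) (auto elim!: oddE)
      moreover have "Suc (2 * j) + q = Suc (2 * (j + r))"
        using r by simp
      ultimately show ?thesis
        by (metis add_left_cancel thue_morse_double(2))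
    qed
    with less.IH[of r "a div 2"] less.prems(1) r show False by auto
  qed
qed

section \<open>Cubes in \<open>1y1\<close> and in its image under \<open>mu\<close>\<close>

definition cube_at :: "(nat \<Rightarrow> 'a) \<Rightarrow> nat \<Rightarrow> nat \<Rightarrow> bool" where
  "cube_at f a p \<longleftrightarrow> 0 < p \<and> (\<forall>k. a \<le> k \<longrightarrow> k < a + 2 * p \<longrightarrow> f k = f (k + p))"

lemma cubefree_nthI:
  assumes "\<And>a p. a + 3 * p \<le> length w \<Longrightarrow> \<not> cube_at (\<lambda>k. w ! k) a p"
  shows "cubefree w"
  unfolding cubefree_def
proof
  assume "\<exists>v. sublist v w \<and> cube v"
  then obtain v where "sublist v w" "cube v" by blast
  then obtain l u r where w: "w = l @ v @ r" and v: "v = u @ u @ u" and u: "u \<noteq> []"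
    unfolding sublist_def cube_def by blast
  have "w ! k = w ! (k + length u)" if "length l \<le> k" "k < length l + 2 * length u" for k
  proof -
    from that obtain j where k: "k = length l + j" and j: "j < 2 * length u"
      by (metis add_less_cancel_left le_Suc_ex)
    have "w ! k = (u @ u @ u @ r) ! j" "w ! (k + length u) = (u @ u @ u @ r) ! (j + length u)"
      unfolding w v k by (simp_all add: nth_append)
    with j show ?thesis
      by (auto simp: nth_append)
  qed
  then have "cube_at (\<lambda>k. w ! k) (length l) (length u)"
    using u by (simp add: cube_at_def)
  with assms[of "length l" "length u"] w v show False by simp
qed

text \<open>The word \<open>1y1\<close> at positions \<open>0, \<dots>, h + 1\<close>, with \<open>y\<close> at positions \<open>1, \<dots>, h\<close>.\<close>

lemma no_cube_extended:
  assumes overlap_free: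
      "\<And>k q. 0 < q \<Longrightarrow> 1 \<le> k \<Longrightarrow> k + 2 * q \<le> h \<Longrightarrow> \<exists>j. k \<le> j \<and> j \<le> k + q \<and> v j \<noteq> v (j + q)"
    and h: "2 \<le> h"
    and v: "v 0 \<noteq> v 2" "v 1 \<noteq> v 2" "v h \<noteq> v (h + 1)"
    and k: "k + 3 * q \<le> h + 2"
  shows "\<not> cube_at v k q"
proof
  assume cube: "cube_at v k q"
  then have q: "0 < q" by (simp add: cube_at_def)
  have per: "v j = v (j + q)" if "k \<le> j" "j < k + 2 * q" for j
    using cube that by (simp add: cube_at_def)
  \<comment> \<open>The cube contains an overlap of period \<open>q\<close> at each of its first
    \<open>q\<close> positions; none of these may lie inside \<open>y\<close>.\<close>
  have long: "\<not> l + 2 * q \<le> h" if "1 \<le> l" "k \<le> l" "l < k + q" for l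
  proof
    assume "l + 2 * q \<le> h"
    from overlap_free[OF q that(1) this] obtain j where "l \<le> j" "j \<le> l + q" "v j \<noteq> v (j + q)"
      by blast
    with that per show False by force
  qed
  show False
  proof (cases "k = 0")
    case True
    \<comment> \<open>For \<open>q >= 3\<close> the overlap at 1 already fits into
      \<open>y\<close>.\<close>
    consider "q = 1" | "q = 2" | "q \<ge> 2" "1 + 2 * q \<le> h"
      using k q True by linarith
    then show False
    proof cases
      case 1
      with per[of 1] v True show False by (simp add: numeral_2_eq_2)
    next
      case 2
      with per[of 0] v True show False by (simp add: numeral_2_eq_2)
    next
      case 3
      with long[of 1] True show False by simp
    qed
  next
    case False
    then have "\<not> k + 2 * q \<le> h"
      using long[of k] q by simp
    with k q have "q = 1" "k + 1 = h" by linarith+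
    with per[of h] v show False by simp
  qed
qed

text \<open>The function in the hypothesis is the image of \<open>v\<close> under \<open>mu\<close>.
  Its letters at positions of the parity of \<open>b\<close> give back \<open>v\<close>,
  complemented if \<open>b\<close> is odd, with half the period.\<close>

lemma cube_at_mu:
  fixes v :: "nat \<Rightarrow> bit"
  assumes "cube_at (\<lambda>k. if even k then v (k div 2) else 1 + v (k div 2)) b (2 * q)"
  shows "cube_at v (b div 2) q"
  unfolding cube_at_def
proof (intro conjI allI impI)
  show "0 < q" using assms by (simp add: cube_at_def)
next
  fix k
  assume k: "b div 2 \<le> k" "k < b div 2 + 2 * q"
  show "v k = v (k + q)"
  proof (cases "even b")
    case True
    with k have "b \<le> 2 * k" "2 * k < b + 2 * (2 * q)"
      by (auto elim!: evenE)
    with assms have "v (2 * k div 2) = v ((2 * k + 2 * q) div 2)"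
      unfolding cube_at_def by fastforce
    then show ?thesis by simp
  next
    case False
    with k have "b \<le> Suc (2 * k)" "Suc (2 * k) < b + 2 * (2 * q)"
      by (auto elim!: oddE)
    with assms have "1 + v (Suc (2 * k) div 2) = 1 + v ((Suc (2 * k) + 2 * q) div 2)"
      unfolding cube_at_def by fastforce
    moreover have "Suc (2 * k) div 2 = k" "(Suc (2 * k) + 2 * q) div 2 = k + q" by simp_all
    ultimately show ?thesis by (metis add_left_cancel)
  qed
qed

section \<open>Cubes in a word with four exceptional blocks\<close>

text \<open>
  \<open>w\<close> stands for \<open>x101100x101100\<close> with \<open>|x| = c + 4\<close>; the pairs at \<open>c + 6\<close> and \<open>c + 8\<close>, and their
  translates by \<open>N = |x101100|\<close>, are the exceptional blocks.
\<close>

locale junction_word =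
  fixes w :: "nat \<Rightarrow> bit" and c N :: nat
  assumes N: "N = c + 10" and even_c: "even c"
    and aligned: "\<And>k. even k \<Longrightarrow> k < 2 * N \<Longrightarrow> w k = w (Suc k) \<Longrightarrow>
      k \<in> {c + 6, c + 8, N + c + 6, N + c + 8}"
    and letters:
      "w c = 1" "w (c + 1) = 0" "w (c + 2) = 0" "w (c + 3) = 1" "w (c + 4) = 1"
      "w (c + 5) = 0" "w (c + 6) = 1" "w (c + 7) = 1" "w (c + 8) = 0" "w (c + 9) = 0"
      "w (c + 10) = 1" "w (c + 11) = 0" "w (c + 12) = 0" "w (c + 13) = 1"
      "w (N + c) = 1" "w (N + c + 1) = 0" "w (N + c + 2) = 0" "w (N + c + 3) = 1"
      "w (N + c + 4) = 1" "w (N + c + 5) = 0" "w (N + c + 6) = 1" "w (N + c + 7) = 1"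
      "w (N + c + 8) = 0" "w (N + c + 9) = 0"
begin

text \<open>A cube spans three periods, so a pair inside it stays inside when moved by
  \<open>p\<close> to the right or else to the left. The parity condition makes the new position
  even, where \<open>aligned\<close> applies.\<close>

lemma shifted_pair:
  assumes "cube_at w a p" "a + 3 * p \<le> 2 * N" "even k = even p"
    and "a \<le> k" "k' < a + 3 * p" "k' = Suc k" "w k = w k'"
  obtains b where "b \<in> {c + 6, c + 8, N + c + 6, N + c + 8}" "a \<le> b" "Suc b < a + 3 * p"
    "b = k + p \<or> k = b + p"
proof (cases "k' < a + 2 * p")
  case True
  then have "w (k + p) = w (Suc (k + p))"
    using assms by (auto simp: cube_at_def)
  moreover have "even (k + p)" "k + p < 2 * N"
    using assms True by auto
  ultimately show ?thesis
    using aligned[of "k + p"] that[of "k + p"] assms True by simp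
next
  case False
  define b where "b = k - p"
  have b: "k = b + p" "a \<le> b" "Suc b < a + 2 * p"
    using False assms(1,5,6) by (auto simp: b_def cube_at_def)
  then have "w b = w (b + p)" "w (Suc b) = w (Suc b + p)"
    using assms(1) unfolding cube_at_def by auto
  with b assms have "w b = w (Suc b)" by simp
  moreover have "even b" "b < 2 * N"
    using assms b by auto
  ultimately show ?thesis
    using aligned[of b] that[of b] b by simp
qed

lemma no_odd_cube:
  assumes "odd p" and len: "a + 3 * p \<le> 2 * N"
  shows "\<not> cube_at w a p"
proof
  assume cube: "cube_at w a p"
  have mismatch: "\<not> (a \<le> k \<and> k < a + 2 * p)" if "w k = x" "w l = y" "x \<noteq> y" "l = k + p" for k l x y
    using cube that by (auto simp: cube_at_def)
  have p: "0 < p" using cube by (simp add: cube_at_def)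
  have "w a = w (a + p)" using cube by (simp add: cube_at_def)
  then obtain j where j: "a \<le> j" "j < a + p" "w j = w (Suc j)"
    using odd_period_equal_pair[OF assms(1)] by metis
  have "\<exists>b. b \<in> {c + 6, c + 8, N + c + 6, N + c + 8} \<and> a \<le> b \<and> Suc b < a + 3 * p"
  proof (cases "even j")
    case True
    with aligned[of j] j len show ?thesis by force
  next
    case False
    have "Suc j < a + 3 * p" using j p by linarith
    with shifted_pair[OF cube len, of j "Suc j"] j False assms(1) show ?thesis
      by metis
  qed
  then obtain b where b: "b = c + 6 \<or> b = c + 8 \<or> b = N + c + 6 \<or> b = N + c + 8"
      "a \<le> b" "Suc b < a + 3 * p"
    by blast
  \<comment> \<open>From 7 on, \<open>p\<close> exceeds the distances 3 and 5 between the odd pairs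
    used below and their nearby exceptional blocks; smaller periods are checked by letters.\<close>
  have "p = 1 \<or> p = 3 \<or> p = 5 \<or> 7 \<le> p"
    using assms(1) by presburger
  then consider "p = 1" | "p = 3" | "p = 5" | "7 \<le> p" by blast
  then show False
  proof cases
    case 1
    have "\<not> (a \<le> c + 5 \<and> c + 5 < a + 2)" "\<not> (a \<le> c + 7 \<and> c + 7 < a + 2)"
      "\<not> (a \<le> c + 9 \<and> c + 9 < a + 2)" "\<not> (a \<le> N + c + 5 \<and> N + c + 5 < a + 2)"
      "\<not> (a \<le> N + c + 7 \<and> N + c + 7 < a + 2)"
      using mismatch[OF letters(6) letters(7)] mismatch[OF letters(8) letters(9)]
        mismatch[OF letters(10) letters(11)]
        mismatch[OF letters(20) letters(21)] mismatch[OF letters(22) letters(23)] 1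
      by simp_all
    with b 1 len N show False by linarith
  next
    case 2
    have m: "\<not> (a \<le> c + 1 \<and> c + 1 < a + 6)" "\<not> (a \<le> c + 6 \<and> c + 6 < a + 6)"
      "\<not> (a \<le> N + c + 1 \<and> N + c + 1 < a + 6)"
      using mismatch[OF letters(2) letters(5)] mismatch[OF letters(7) letters(10)]
        mismatch[OF letters(16) letters(19)] 2
      by simp_all
    with b 2 len N have a: "a = c + 7 \<or> a = c + 8" by linarith
    have per: "w l = w k" if "a \<le> k" "k < a + 2 * p" "l = k + p" for k l
      using cube that by (simp add: cube_at_def)
    \<comment> \<open>The letters at \<open>c + 14\<close> and \<open>c + 15\<close> are not given,
      but period 3 copies the pair \<open>00\<close> from \<open>c + 11\<close> to the even position
      \<open>c + 14\<close>, which is not exceptional.\<close>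
    have "w (c + 14) = w (c + 11)" "w (c + 15) = w (c + 12)"
      by (rule per; use a 2 in auto)+
    moreover have "Suc (c + 14) = c + 15" by simp
    ultimately have "w (c + 14) = w (Suc (c + 14))"
      using letters by metis
    with aligned[of "c + 14"] even_c a 2 len N show False by auto
  next
    case 3
    have "\<not> (a \<le> c \<and> c < a + 10)" "\<not> (a \<le> c + 8 \<and> c + 8 < a + 10)"
      "\<not> (a \<le> c + 6 \<and> c + 6 < a + 10)"
      "\<not> (a \<le> N + c \<and> N + c < a + 10)"
      using mismatch[OF letters(1) letters(6)] mismatch[OF letters(9) letters(14)]
        mismatch[OF letters(7) letters(12)] mismatch[OF letters(15) letters(20)] 3
      by simp_all
    with b 3 len N show False by linarith
  next
    case 4
    \<comment> \<open>This is the pair \<open>11\<close> where \<open>x\<close> meets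
      \<open>101100\<close>.\<close>
    have A: "\<not> (a \<le> c + 3 \<and> c + 4 < a + 3 * p)"
    proof
      assume "a \<le> c + 3 \<and> c + 4 < a + 3 * p"
      with letters even_c assms(1) obtain b'
        where "b' \<in> {c + 6, c + 8, N + c + 6, N + c + 8}" "b' = c + 3 + p \<or> c + 3 = b' + p"
        using shifted_pair[OF cube len, of "c + 3" "c + 4"] by auto
      then show False using 4 len N by auto
    qed
    \<comment> \<open>The distance \<open>N - 3\<close> is too long, since
      \<open>3 * (N - 3) > 2 * N\<close>; only \<open>N - 5\<close> remains, here and in
      \<open>C\<close>.\<close>
    have B: "p + 5 = N" if "a \<le> c + 11 \<and> c + 12 < a + 3 * p"
    proof -
      from that letters even_c assms(1) obtain b'
        where "b' \<in> {c + 6, c + 8, N + c + 6, N + c + 8}" "b' = c + 11 + p \<or> c + 11 = b' + p"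
        using shifted_pair[OF cube len, of "c + 11" "c + 12"] by auto
      then show ?thesis using 4 len N by auto
    qed
    have C: "p + 5 = N" if "a \<le> N + c + 3 \<and> N + c + 4 < a + 3 * p"
    proof -
      from that letters even_c N assms(1) obtain b'
        where "b' \<in> {c + 6, c + 8, N + c + 6, N + c + 8}" "b' = N + c + 3 + p \<or> N + c + 3 = b' + p"
        using shifted_pair[OF cube len, of "N + c + 3" "N + c + 4"] by auto
      then show ?thesis using 4 len N by auto
    qed
    \<comment> \<open>With at least 21 letters, a cube reaching an exceptional block covers one of
      the three pairs.\<close>
    have pN: "p + 5 = N"
      using b
    proof (elim disjE)
    qed (use A B C b 4 len N in linarith)+
    then have "c + 8 + p = N + c + 3" by simp
    then have "\<not> (a \<le> c + 8 \<and> c + 8 < a + 2 * p)"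
      using mismatch[OF letters(9) letters(18)] by simp
    with A b pN 4 len N show False by linarith
  qed
qed

text \<open>An exceptional block inside the cube moves onto another one. The length bound leaves
  only distance 2, where the letters differ. So the cube meets at most half of a block at either
  end, and the remaining gaps are too short for its at least 6 letters.\<close>

lemma even_cube_location:
  assumes "even p" and len: "a + 3 * p \<le> 2 * N" and cube: "cube_at w a p"
  shows "a + 3 * p \<le> c + 7 \<or> c + 9 \<le> a \<and> a + 3 * p \<le> N + c + 7"
proof -
  have p: "2 \<le> p" using assms(1) cube by (auto simp: cube_at_def elim!: evenE)
  have mismatch: "\<not> (a \<le> k \<and> k < a + 2 * p)" if "w k = x" "w l = y" "x \<noteq> y" "l = k + p" for k l x y
    using cube that by (auto simp: cube_at_def)
  have no_block: "\<not> (a \<le> k \<and> Suc k < a + 3 * p)"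
    if k: "k \<in> {c + 6, c + 8, N + c + 6, N + c + 8}" for k
  proof
    assume in_range: "a \<le> k \<and> Suc k < a + 3 * p"
    have suc: "Suc (c + 6) = c + 7" "Suc (c + 8) = c + 9"
      "Suc (N + c + 6) = N + c + 7" "Suc (N + c + 8) = N + c + 9"
      by simp_all
    have "w k = w (Suc k)"
      using k letters unfolding insert_iff empty_iff by (elim disjE) (simp_all only: suc)
    moreover have "even k"
      using k even_c N by auto
    ultimately obtain b
      where b: "b \<in> {c + 6, c + 8, N + c + 6, N + c + 8}" "a \<le> b" "Suc b < a + 3 * p"
        "b = k + p \<or> k = b + p"
      using shifted_pair[OF cube len, of k "Suc k"] assms(1) in_range by metis
    have p2: "p = 2"
      using k b(1,4) p len N by auto
    with mismatch[OF letters(7) letters(9)] mismatch[OF letters(21) letters(23)]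
    have "\<not> (a \<le> c + 6 \<and> c + 6 < a + 4)" "\<not> (a \<le> N + c + 6 \<and> N + c + 6 < a + 4)"
      by simp_all
    with k b p2 in_range N show False by auto
  qed
  from no_block[of "c + 6"] no_block[of "c + 8"] no_block[of "N + c + 6"] no_block[of "N + c + 8"]
  show ?thesis using p len N by simp linarith
qed

end

section \<open>The word \<open>x101100x101100\<close>\<close>

theorem theorem8:
  fixes x x' x'' :: "bit list"
  assumes "factor_of_inf x thue_morse"
    and "x = [1, 0, 0, 1] @ x''"
    and "x = x' @ [1, 0, 0, 1]"
  shows "cubefree (x @ [1, 0, 1, 1, 0, 0] @ x @ [1, 0, 1, 1, 0, 0])"
proof -
  define z :: "bit list" where "z = [1, 0, 1, 1, 0, 0]"
  let ?t = thue_morse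
  obtain i where x: "x = map ?t [i..<i + length x]"
    using assms(1) by (auto simp: factor_of_inf_def)
  obtain c where c: "length x = c + 4"
    using assms(3) by simp
  have nth_x: "x ! k = ?t (i + k)" if "k < c + 4" for k
    by (subst x) (use that c in \<open>simp del: upt_Suc\<close>)
  have x_start: "?t i = 1" "?t (i + 1) = 0" "?t (i + 2) = 0" "?t (i + 3) = 1"
    using nth_x[of 0] nth_x[of 1] nth_x[of 2] nth_x[of 3] assms(2) by (simp_all add: eval_nat_numeral)
  have "length x' = c"
    using assms(3) c by simp
  then have x_end: "?t (i + c) = 1" "?t (i + c + 1) = 0" "?t (i + c + 2) = 0" "?t (i + c + 3) = 1"
    using nth_x[of c] nth_x[of "c + 1"] nth_x[of "c + 2"] nth_x[of "c + 3"] assms(3)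
    by (simp_all add: nth_append add.assoc)
  \<comment> \<open>The pair \<open>00\<close> inside \<open>1001\<close> cannot be an aligned
    block.\<close>
  have even_i: "even i"
    using thue_morse_pair[of "i + 1"] x_start by auto
  have "even (i + c)"
    using thue_morse_pair[of "i + c + 1"] x_end by auto
  with even_i have even_c: "even c" by simp

  define N where "N = c + 10"
  define W where "W = (x @ z) @ (x @ z)"
  have len_W: "length W = 2 * N"
    by (simp add: W_def z_def c N_def)
  have len_xz: "length (x @ z) = N"
    by (simp add: z_def c N_def)
  have W_nth: "W ! k = (x @ z) ! k" "W ! (N + k) = (x @ z) ! k" if "k < N" for k
    using that len_xz unfolding W_def by (metis nth_append, metis nth_append_length_plus)
  have xz_x: "(x @ z) ! k = ?t (i + k)" if "k < c + 4" for k
    using that nth_x c by (simp add: nth_append)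
  have xz_z: "(x @ z) ! (c + 4 + k) = z ! k" for k
    using c by (metis nth_append_length_plus)
  have xz_letters: "(x @ z) ! c = 1" "(x @ z) ! (c + 1) = 0" "(x @ z) ! (c + 2) = 0"
    "(x @ z) ! (c + 3) = 1" "(x @ z) ! (c + 4) = 1" "(x @ z) ! (c + 5) = 0" "(x @ z) ! (c + 6) = 1"
    "(x @ z) ! (c + 7) = 1" "(x @ z) ! (c + 8) = 0" "(x @ z) ! (c + 9) = 0"
    using x_end xz_x[of c] xz_x[of "c + 1"] xz_x[of "c + 2"] xz_x[of "c + 3"]
      xz_z[of 0] xz_z[of 1] xz_z[of 2] xz_z[of 3] xz_z[of 4] xz_z[of 5]
    by (simp_all add: z_def add.assoc eval_nat_numeral)
  have xz_start: "(x @ z) ! 0 = 1" "(x @ z) ! 1 = 0" "(x @ z) ! 2 = 0" "(x @ z) ! 3 = 1"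
    using x_start xz_x[of 0] xz_x[of 1] xz_x[of 2] xz_x[of 3] by simp_all
  have xz_aligned: "k = c + 6 \<or> k = c + 8"
    if "even k" "k < N" "(x @ z) ! k = (x @ z) ! Suc k" for k
  proof (cases "k < c + 4")
    case True
    with that(1) even_c have "Suc k < c + 4"
      by (metis even_Suc even_add even_numeral Suc_lessI)
    with True that xz_x[of k] xz_x[of "Suc k"] even_i thue_morse_pair[of "i + k"] show ?thesis
      by simp
  next
    case False
    with that(1,2) even_c have "k = c + 4 \<or> k = c + 6 \<or> k = c + 8"
      unfolding N_def by presburger
    with that(3) xz_letters show ?thesis
      by (auto simp: eval_nat_numeral)
  qed

  interpret junction_word "\<lambda>k. W ! k" c N
  proof
    fix k
    assume k: "even k" "k < 2 * N" "W ! k = W ! Suc k"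
    have even_N: "even N" using even_c by (simp add: N_def)
    show "k \<in> {c + 6, c + 8, N + c + 6, N + c + 8}"
    proof (cases "k < N")
      case True
      with k(1) even_N have "Suc k < N" by (metis even_Suc Suc_lessI)
      with True k W_nth xz_aligned[of k] show ?thesis by auto
    next
      case False
      then obtain l where l: "k = N + l" by (metis le_Suc_ex linorder_not_less)
      with k even_N have "even l" "l < N" by auto
      moreover from this even_N have "Suc l < N" by (metis even_Suc Suc_lessI)
      ultimately show ?thesis
        using k(3) l W_nth(2)[of l] W_nth(2)[of "Suc l"] xz_aligned[of l] by auto
    qed
  next
    have "W ! (c + k) = (x @ z) ! (c + k)" "W ! (N + c + k) = (x @ z) ! (c + k)" if "k < 10" for k
      using W_nth[of "c + k"] that by (simp_all add: N_def add.assoc)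
    note junction = this
    have "W ! (c + (10 + k)) = (x @ z) ! k" if "k < 4" for k
      using W_nth(2)[of k] that by (simp add: N_def add.assoc)
    from this[of 0] this[of 1] this[of 2] this[of 3]
    show "W ! (c + 10) = 1" "W ! (c + 11) = 0" "W ! (c + 12) = 0" "W ! (c + 13) = 1"
      using xz_start by simp_all
    show "W ! c = 1" "W ! (N + c) = 1"
      using junction[of 0] xz_letters by simp_all
    show "W ! (c + 1) = 0" "W ! (c + 2) = 0" "W ! (c + 3) = 1" "W ! (c + 4) = 1"
      "W ! (c + 5) = 0" "W ! (c + 6) = 1" "W ! (c + 7) = 1" "W ! (c + 8) = 0" "W ! (c + 9) = 0"
      "W ! (N + c + 1) = 0" "W ! (N + c + 2) = 0" "W ! (N + c + 3) = 1" "W ! (N + c + 4) = 1"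
      "W ! (N + c + 5) = 0" "W ! (N + c + 6) = 1" "W ! (N + c + 7) = 1" "W ! (N + c + 8) = 0"
      "W ! (N + c + 9) = 0"
      by (subst junction; simp add: xz_letters[simplified])+
  qed (simp_all add: N_def even_c)

  \<comment> \<open>\<open>h\<close> is the length of \<open>y\<close>, \<open>v\<close> is
    \<open>1y1\<close> continued by ones, and \<open>u\<close> is its image under \<open>mu\<close>.
    Thus \<open>u 1\<close> is the \<open>0\<close> before the second \<open>x\<close>,
    \<open>x\<close> starts at \<open>u 2\<close>, and \<open>v (h + 1)\<close> and
    \<open>v (h + 2)\<close> supply the \<open>101\<close> after \<open>x\<close>.\<close>
  define h where "h = c div 2 + 2"
  define v where "v k = (if 1 \<le> k \<and> k \<le> h then ?t (i div 2 + k - 1) else 1)" for k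
  define u where "u k = (if even k then v (k div 2) else 1 + v (k div 2))" for k
  have c_h: "c + 4 = 2 * h" using even_c by (simp add: h_def)
  have u_shift: "u (k + 2) = ?t (i + k)" if "k < c + 4" for k
  proof -
    have k: "k div 2 < h" using that c_h by auto
    have "?t (i + k) = (if even k then ?t (i div 2 + k div 2) else 1 + ?t (i div 2 + k div 2))"
    proof (cases "even k")
      case True
      with even_i have "i + k = 2 * (i div 2 + k div 2)" by auto
      with True show ?thesis by (metis thue_morse_double(1))
    next
      case False
      with even_i have "i + k = Suc (2 * (i div 2 + k div 2))" by presburger
      with False show ?thesis by (metis thue_morse_double(2))
    qed
    with k show ?thesis by (simp add: u_def v_def)
  qed
  have u_xz: "u (k + 2) = (x @ z) ! k" if "k < c + 7" for k
  proof (cases "k < c + 4")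
    case True
    then show ?thesis using u_shift xz_x by simp
  next
    case False
    with that have "k = c + 4 \<or> k = c + 5 \<or> k = c + 6" by linarith
    moreover have "u (2 * h + 2) = 1" "u (2 * h + 3) = 0" "u (2 * h + 4) = 1"
      by (simp_all add: u_def v_def)
    moreover have "c + 4 + 2 = 2 * h + 2" "c + 5 + 2 = 2 * h + 3" "c + 6 + 2 = 2 * h + 4"
      using c_h by simp_all
    ultimately show ?thesis using xz_letters by metis
  qed
  have no_cube_u: "\<not> cube_at u b p" if "even p" "b + 3 * p \<le> c + 9" for b p
  proof
    assume "cube_at u b p"
    moreover obtain q where q: "p = 2 * q" using \<open>even p\<close> by (elim evenE)
    ultimately have "cube_at v (b div 2) q"
      unfolding u_def by (intro cube_at_mu) simp
    moreover have "\<not> cube_at v (b div 2) q"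
    proof (rule no_cube_extended)
      fix k q :: nat
      assume kq: "0 < q" "1 \<le> k" "k + 2 * q \<le> h"
      obtain j where j: "i div 2 + k - 1 \<le> j" "j \<le> i div 2 + k - 1 + q" "?t j \<noteq> ?t (j + q)"
        using thue_morse_overlap_free[OF kq(1), of "i div 2 + k - 1"] by blast
      define l where "l = j + 1 - i div 2"
      have l: "j = i div 2 + l - 1" "k \<le> l" "l \<le> k + q" "j + q = i div 2 + (l + q) - 1"
        using j kq by (auto simp: l_def)
      with j(3) kq have "v l \<noteq> v (l + q)"
        by (simp add: v_def)
      with l show "\<exists>j. k \<le> j \<and> j \<le> k + q \<and> v j \<noteq> v (j + q)" by blast
    next
      show "2 \<le> h" by (simp add: h_def)
    next
      have "u 2 = 1" "u 4 = 0" "u (c + 4) = 0"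
        using u_xz[of 0] u_xz[of 2] u_xz[of "c + 2"] xz_start xz_letters by (simp_all add: eval_nat_numeral)
      moreover have "u 2 = v 1" "u 4 = v 2" "u (c + 4) = v h"
        by (simp_all add: u_def c_h)
      ultimately show "v 0 \<noteq> v 2" "v 1 \<noteq> v 2" "v h \<noteq> v (h + 1)"
        by (simp_all add: v_def)
    next
      \<comment> \<open>Here \<open>c + 9 = 2 * h + 5\<close>, and halving rounds down: the half
        block \<open>u (c + 8)\<close> adds no letter of \<open>v\<close>.\<close>
      show "b div 2 + 3 * q \<le> h + 2"
        using that(2) q c_h by linarith
    qed
    ultimately show False by contradiction
  qed

  have "cubefree W"
  proof (rule cubefree_nthI)
    fix a p
    assume len: "a + 3 * p \<le> length W"
    show "\<not> cube_at (\<lambda>k. W ! k) a p"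
    proof
      assume cube: "cube_at (\<lambda>k. W ! k) a p"
      with no_odd_cube[of p a] len len_W have p: "even p" by auto
      consider "a + 3 * p \<le> c + 7" | "c + 9 \<le> a" "a + 3 * p \<le> N + c + 7"
        using even_cube_location[OF p _ cube] len len_W by auto
      then show False
      proof cases
        case 1
        then have W_u: "W ! k = u (k + 2)" if "k < a + 3 * p" for k
          using that W_nth(1)[of k] u_xz[of k] by (simp add: N_def)
        have "u k = u (k + p)" if "a + 2 \<le> k" "k < a + 2 + 2 * p" for k
        proof -
          define l where "l = k - 2"
          have "k = l + 2" "a \<le> l" "l < a + 2 * p"
            using that by (auto simp: l_def)
          with cube W_u[of l] W_u[of "l + p"] show ?thesis
            by (simp add: cube_at_def)
        qed
        with cube have "cube_at u (a + 2) p" by (simp add: cube_at_def)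
        with no_cube_u[OF p, of "a + 2"] 1 show False by simp
      next
        case 2
        \<comment> \<open>The offset \<open>c + 8\<close> puts the second \<open>x\<close>, which
          starts at \<open>N = c + 10\<close>, at position 2 of \<open>u\<close>.\<close>
        then have W_u: "W ! (k + c + 8) = u k" if "1 \<le> k" "k + c + 8 < a + 3 * p" for k
        proof (cases "k = 1")
          case True
          have "v 0 = 1" by (simp add: v_def)
          then have "u 1 = 0" by (simp add: u_def)
          with True letters(10) show ?thesis by (simp add: add.commute)
        next
          case False
          define l where "l = k - 2"
          have "k = l + 2" using that(1) False by (auto simp: l_def)
          with that 2 W_nth(2)[of l] u_xz[of l] show ?thesis
            by (simp add: N_def ac_simps)
        qed
        define b where "b = a - (c + 8)"
        have a: "a = b + c + 8" "1 \<le> b" using 2 by (auto simp: b_def)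
        have "u k = u (k + p)" if "b \<le> k" "k < b + 2 * p" for k
        proof -
          have "W ! (k + c + 8) = W ! (k + c + 8 + p)"
            using cube that a by (simp add: cube_at_def)
          also have "k + c + 8 + p = k + p + c + 8" by simp
          finally show ?thesis
            using W_u[of k] W_u[of "k + p"] that a by simp
        qed
        with cube have "cube_at u b p" by (simp add: cube_at_def)
        with no_cube_u[OF p, of b] 2 a show False by (simp add: N_def)
      qed
    qed
  qed
  then show ?thesis by (simp add: W_def z_def)
qed

end
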